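(* Let $\mathbf p$ be the bivincular pattern $(231,\{0,1\},\{0,1,2\})$, and regard two permutations as equivalent if they have the same cycle type. Then for every $n\ge 1$, $\widetilde{\mathfrak A}_n(\mathbf p)$ is the set of involutions in $\mathfrak S_n$ (permutations $\pi$ with $\pi^2=\mathrm{id}$, including the identity). The cardinalities $|\widetilde{\mathfrak A}_n(\mathbf p)|$ are $1,2,4,10,26,76,232,764,2620,\dots$ for $n=1,2,3,\dots$, and have exponential generating function $\exp(x+x^2/2)$.
   Context: Permutations in $\mathfrak S_n$ are written in one-line notation $\pi=\pi_1\cdots\pi_n$. A bivincular pattern is a triple $(p,X,Y)$ with $p\in\mathfrak S_k$ and $X,Y\subseteq\{0,1,\dots,k\}$. An occurrence of $(p,X,Y)$ in $\pi\in\mathfrak S_n$ is a subsequence $\pi_{i_1}\cdots\pi_{i_k}$ ($i_1<\cdots<i_k$) whose letters are in the same relative order as the letters of $p$, such that $i_{x+1}=i_x+1$ for all $x\in X$, and $j_{y+1}=j_y+1$ for all $y\in Y$, where $\{\pi_{i_1},\dots,\pi_{i_k}\}=\{j_1<\cdots<j_k\}$ and by convention $i_0=j_0=0$, $i_{k+1}=j_{k+1}=n+1$. A permutation avoids a pattern if it has no occurrence of it. $\widetilde{\mathfrak A}_n(\mathbf p)$ is the set of $\pi\in\mathfrak S_n$ such that $\pi$ and every permutation equivalent to $\pi$ avoids $\mathbf p$. The exponential generating function is normalized with constant term $1$ (for $n=0$). *)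

theory Defs
  imports
    "HOL-Combinatorics.Permutations"
    "HOL-Combinatorics.Orbits"
    "HOL-Library.Multiset"
    "HOL-Computational_Algebra.Formal_Power_Series"
begin

text \<open>
  The permutation $\pi_1 \cdots \pi_n$ is the function \<open>\<pi>\<close> on \<open>nat\<close> with \<open>\<pi> a\<close> the \<open>a\<close>-th letter
  for \<open>1 \<le> a \<le> n\<close> and \<open>\<pi> a = a\<close> elsewhere.
\<close>

definition sym_perms :: "nat \<Rightarrow> (nat \<Rightarrow> nat) set" where
  "sym_perms n = {\<pi>. \<pi> permutes {1..n}}"

text \<open>
  The underlying permutation of a pattern \<open>(p, X, Y)\<close> is a word in one-line notation. Letters
  are counted from 1, so that the \<open>a\<close>-th letter is \<open>p ! (a - 1)\<close>.
\<close>

type_synonym pattern = "nat list \<times> nat set \<times> nat set"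

fun bivincular_pattern :: "pattern \<Rightarrow> bool" where
  "bivincular_pattern (p, X, Y) \<longleftrightarrow>
     distinct p \<and> set p = {1..length p} \<and> X \<subseteq> {0..length p} \<and> Y \<subseteq> {0..length p}"

text \<open>
  The occurrence is given by its positions \<open>i 1 < \<dots> < i k\<close>; the function \<open>j\<close> enumerates its
  letters in increasing order. Both are extended to the arguments \<open>0\<close> and \<open>k + 1\<close> by the values
  \<open>0\<close> and \<open>n + 1\<close>; further values are irrelevant.
\<close>

fun occurrence :: "nat \<Rightarrow> (nat \<Rightarrow> nat) \<Rightarrow> pattern \<Rightarrow> (nat \<Rightarrow> nat) \<Rightarrow> bool" where
  "occurrence n \<pi> (p, X, Y) i \<longleftrightarrow>
     (let k = length p in
        i ` {1..k} \<subseteq> {1..n} \<and> strict_mono_on {1..k} i \<and> i 0 = 0 \<and> i (k + 1) = n + 1 \<and>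
        (\<forall>a\<in>{1..k}. \<forall>b\<in>{1..k}. \<pi> (i a) < \<pi> (i b) \<longleftrightarrow> p ! (a - 1) < p ! (b - 1)) \<and>
        (\<forall>x\<in>X. i (x + 1) = i x + 1) \<and>
        (\<exists>j. j ` {1..k} = (\<lambda>a. \<pi> (i a)) ` {1..k} \<and> strict_mono_on {1..k} j \<and>
             j 0 = 0 \<and> j (k + 1) = n + 1 \<and>
             (\<forall>y\<in>Y. j (y + 1) = j y + 1)))"

definition avoids :: "nat \<Rightarrow> (nat \<Rightarrow> nat) \<Rightarrow> pattern \<Rightarrow> bool" where
  "avoids n \<pi> P \<longleftrightarrow> (\<nexists>i. occurrence n \<pi> P i)"

text \<open>
  The permutations in the symmetric group on \<open>{1..n}\<close> whose whole class under the equivalence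
  relation \<open>R\<close> avoids the pattern.
\<close>

definition class_avoiders ::
    "((nat \<Rightarrow> nat) \<Rightarrow> (nat \<Rightarrow> nat) \<Rightarrow> bool) \<Rightarrow> nat \<Rightarrow> pattern \<Rightarrow> (nat \<Rightarrow> nat) set" where
  "class_avoiders R n P =
     {\<pi> \<in> sym_perms n. avoids n \<pi> P \<and> (\<forall>\<sigma>\<in>sym_perms n. R \<pi> \<sigma> \<longrightarrow> avoids n \<sigma> P)}"

text \<open>The multiset of cycle lengths; every fixed point in \<open>{1..n}\<close> contributes a \<open>1\<close>.\<close>

definition cycle_type :: "nat \<Rightarrow> (nat \<Rightarrow> nat) \<Rightarrow> nat multiset" where
  "cycle_type n \<pi> = image_mset card (mset_set (orbit \<pi> ` {1..n}))"

definition same_cycle_type :: "nat \<Rightarrow> (nat \<Rightarrow> nat) \<Rightarrow> (nat \<Rightarrow> nat) \<Rightarrow> bool" where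
  "same_cycle_type n \<pi> \<sigma> \<longleftrightarrow> cycle_type n \<pi> = cycle_type n \<sigma>"

definition pat231 :: pattern where
  "pat231 = ([2, 3, 1], {0, 1}, {0, 1, 2})"

lemma bivincular_pattern_pat231: "bivincular_pattern pat231"
  by (auto simp: pat231_def)

definition cycle_type_avoiders :: "nat \<Rightarrow> (nat \<Rightarrow> nat) set" where
  "cycle_type_avoiders n = class_avoiders (same_cycle_type n) n pat231"

text \<open>The exponential generating function of \<open>a 1, a 2, \<dots>\<close>, with constant term 1.\<close>

definition egf :: "(nat \<Rightarrow> nat) \<Rightarrow> rat fps" where
  "egf a = Abs_fps (\<lambda>n. if n = 0 then 1 else of_nat (a n) / fact n)"

end

theory Submission
  imports Defs
begin

text \<open>
  In an occurrence of the pattern all three letters are forced to be \<open>2, 3, 1\<close> and the first two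
  positions to be \<open>1, 2\<close>; hence \<open>\<pi>\<close> contains it iff \<open>\<pi> 1 = 2\<close> and \<open>\<pi> 2 = 3\<close>, which puts \<open>1\<close> in a cycle
  of length at least 3. Conversely, a permutation with a cycle through distinct \<open>x\<close>, \<open>\<pi> x\<close>,
  \<open>\<pi> (\<pi> x)\<close> is conjugate to one with \<open>1 \<mapsto> 2 \<mapsto> 3\<close>. Splitting the involutions by the image of one
  point gives \<open>a (n + 2) = a (n + 1) + (n + 1) * a n\<close>, i.e. \<open>F' = (1 + X) * F\<close> for the
  generating function.
\<close>

section \<open>Occurrences of the pattern\<close>

text \<open>From \<open>i 0 = 0\<close> the set \<open>{0, 1}\<close> forces the first two positions
  to be 1 and 2, and from \<open>j 0 = 0\<close> the set \<open>{0, 1, 2}\<close> forces the letters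
  to be 1, 2, 3. Their order then determines which letter stands where.\<close>

lemma occurrence_pat231D:
  assumes "occurrence n \<pi> pat231 i"
  shows "\<pi> 1 = 2 \<and> \<pi> 2 = 3"
proof -
  have s: "{1..3::nat} = {1, 2, 3}" by auto
  from assms obtain j :: "nat \<Rightarrow> nat" where
    i: "i 0 = 0" "i (0 + 1) = i 0 + 1" "i (1 + 1) = i 1 + 1" and
    ord: "\<And>a b. a \<in> {1..3} \<Longrightarrow> b \<in> {1..3} \<Longrightarrow>
            \<pi> (i a) < \<pi> (i b) \<longleftrightarrow> [2, 3, 1::nat] ! (a - 1) < [2, 3, 1] ! (b - 1)" and
    j: "j ` {1..3} = (\<lambda>a. \<pi> (i a)) ` {1..3}" "j 0 = 0" "j (0 + 1) = j 0 + 1"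
       "j (1 + 1) = j 1 + 1" "j (2 + 1) = j 2 + (1::nat)"
    by (auto simp: pat231_def Let_def numeral_eq_Suc)
  have i12: "i 1 = 1" "i 2 = 2" using i by (simp_all add: numeral_2_eq_2)
  have "j 1 = 1" "j 2 = 2" "j 3 = 3" using j(2-5) by (simp_all add: numeral_eq_Suc)
  then have "{\<pi> (i 1), \<pi> (i 2), \<pi> (i 3)} = {1, 2, 3}"
    using j(1) unfolding s by simp
  then have *: "{\<pi> 1, \<pi> 2, \<pi> (i 3)} = {1, 2, 3}" using i12 by simp
  have "\<pi> (i 3) < \<pi> (i 1)" "\<pi> (i 1) < \<pi> (i 2)"
    using ord[of 3 1] ord[of 1 2] by simp_all
  then have lt: "\<pi> (i 3) < \<pi> 1" "\<pi> 1 < \<pi> 2" using i12 by simp_all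
  have "\<pi> 1 \<in> {1, 2, 3}" "\<pi> 2 \<in> {1, 2, 3}" "\<pi> (i 3) \<in> {1, 2, 3}"
    using * by blast+
  then show ?thesis using lt by auto
qed

lemma occurrence_pat231I:
  assumes \<pi>: "\<pi> permutes {1..n}" and "\<pi> 1 = 2" "\<pi> 2 = 3"
  shows "\<exists>i. occurrence n \<pi> pat231 i"
proof -
  \<comment> \<open>Otherwise 1 would be a fixed point, against \<open>\<pi> 1 = 2\<close>.\<close>
  have "1 \<in> {1..n}" using permutes_not_in[OF \<pi>, of 1] assms by force
  then obtain m where m: "m \<in> {1..n}" "\<pi> m = 1"
    using permutes_image[OF \<pi>] by (metis imageE)
  have "m \<noteq> 1" "m \<noteq> 2" using m assms by auto
  then have m3: "3 \<le> m" "m \<le> n" using m(1) by auto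
  have s: "{1..3::nat} = {1, 2, 3}" by auto
  have len: "length [2, 3, 1::nat] = 3" by simp
  \<comment> \<open>The third position is \<open>m\<close>, where the letter 1 stands; the value at
    4 is the boundary convention.\<close>
  define i where "i a = (if a \<le> 2 then a else if a = 3 then m else n + 1)" for a :: nat
  define j where "j a = (if a \<le> 3 then a else n + 1)" for a :: nat
  have i: "i 0 = 0" "i (Suc 0) = 1" "i 1 = 1" "i 2 = 2" "i (Suc (Suc 0)) = 2" "i 3 = m" "i 4 = n + 1" by (simp_all add: i_def)
  have j: "j 0 = 0" "j (Suc 0) = 1" "j 1 = 1" "j 2 = 2" "j (Suc (Suc 0)) = 2" "j 3 = 3" "j 4 = n + 1" by (simp_all add: j_def)
  have "strict_mono_on {1..3} i" "strict_mono_on {1..3} j"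
    using m3 unfolding s by (auto simp: strict_mono_on_def i j)
  moreover have "j ` {1..3} = (\<lambda>a. \<pi> (i a)) ` {1..3}"
    unfolding s using assms m by (auto simp: i j)
  moreover have "i ` {1..3} \<subseteq> {1..n}" unfolding s using m3 by (auto simp: i)
  moreover have "\<forall>a\<in>{1..3}. \<forall>b\<in>{1..3}.
      \<pi> (i a) < \<pi> (i b) \<longleftrightarrow> [2, 3, 1::nat] ! (a - 1) < [2, 3, 1] ! (b - 1)"
    unfolding s using assms m by (simp add: i)
  ultimately have "occurrence n \<pi> pat231 i"
    unfolding pat231_def occurrence.simps Let_def len
    by (intro conjI exI[of _ j]) (simp_all add: i j)
  then show ?thesis by blast
qed

lemma avoids_pat231_iff:
  assumes "\<pi> \<in> sym_perms n"
  shows "avoids n \<pi> pat231 \<longleftrightarrow> \<not> (\<pi> 1 = 2 \<and> \<pi> 2 = 3)"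
  using assms occurrence_pat231I[of \<pi> n] occurrence_pat231D[of n \<pi>]
  unfolding avoids_def sym_perms_def mem_Collect_eq by metis

section \<open>Cycle types\<close>

lemma set_mset_cycle_type: "set_mset (cycle_type n \<pi>) = (\<lambda>x. card (orbit \<pi> x)) ` {1..n}"
  by (auto simp: cycle_type_def)

text \<open>Being an involution can be read off the cycle type, so it is shared by all equivalent
  permutations.\<close>

lemma involution_iff_cycle_type:
  assumes \<pi>: "\<pi> permutes {1..n}"
  shows "\<pi> \<circ> \<pi> = id \<longleftrightarrow> (\<forall>k \<in># cycle_type n \<pi>. k \<le> 2)"
proof
  assume inv: "\<pi> \<circ> \<pi> = id"
  have "orbit \<pi> x \<subseteq> {x, \<pi> x}" for x
  proof
    fix y assume "y \<in> orbit \<pi> x"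
    then show "y \<in> {x, \<pi> x}" by induction (use inv in \<open>auto simp: fun_eq_iff\<close>)
  qed
  then have "card (orbit \<pi> x) \<le> card {x, \<pi> x}" for x
    by (intro card_mono) auto
  also have "card {x, \<pi> x} \<le> 2" for x by (simp add: card_insert_if)
  finally show "\<forall>k \<in># cycle_type n \<pi>. k \<le> 2" by (simp add: set_mset_cycle_type)
next
  assume *: "\<forall>k \<in># cycle_type n \<pi>. k \<le> 2"
  have "\<pi> (\<pi> x) = x" for x
  proof (rule ccontr)
    assume ne: "\<pi> (\<pi> x) \<noteq> x"
    then have "x \<in> {1..n}" using permutes_not_in[OF \<pi>] by metis
    have inj: "\<pi> a = \<pi> b \<longleftrightarrow> a = b" for a b using permutes_inj[OF \<pi>] by (auto dest: injD)
    have fin: "finite (orbit \<pi> x)"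
      using permutes_orbit_subset[OF \<pi> \<open>x \<in> {1..n}\<close>] finite_subset by blast
    \<comment> \<open>The rules of \<open>orbit\<close> produce the iterates from
      \<open>\<pi> x\<close> on, so the three points start there. By injectivity they are distinct
      as soon as \<open>\<pi> (\<pi> x) \<noteq> x\<close>.\<close>
    have "{\<pi> x, \<pi> (\<pi> x), \<pi> (\<pi> (\<pi> x))} \<subseteq> orbit \<pi> x"
      by (auto intro: orbit.intros)
    then have "card {\<pi> x, \<pi> (\<pi> x), \<pi> (\<pi> (\<pi> x))} \<le> card (orbit \<pi> x)"
      by (intro card_mono fin)
    moreover have "card {\<pi> x, \<pi> (\<pi> x), \<pi> (\<pi> (\<pi> x))} = 3"
      using ne by (auto simp: inj card_insert_if)
    moreover have "card (orbit \<pi> x) \<le> 2"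
      using * \<open>x \<in> {1..n}\<close> by (simp add: set_mset_cycle_type)
    ultimately show False by simp
  qed
  then show "\<pi> \<circ> \<pi> = id" by auto
qed

text \<open>Conjugation by \<open>f\<close> carries the orbit of \<open>x\<close> onto the orbit of
  \<open>f x\<close>, and taking images under a bijection preserves both the distinctness of orbits
  and their sizes.\<close>

lemma cycle_type_conjugate:
  assumes f: "f permutes {1..n}" and \<pi>: "\<pi> permutes {1..n}"
  shows "cycle_type n (f \<circ> \<pi> \<circ> inv f) = cycle_type n \<pi>"
proof -
  have bij: "bij f" using permutes_bij[OF f] .
  \<comment> \<open>Finite support puts each point in its own orbit, which
    \<open>orbit_inverse\<close> requires.\<close>
  have "permutation \<pi>" using \<pi> by (auto simp: permutation_permutes)
  then have orbit: "f ` orbit \<pi> x = orbit (f \<circ> \<pi> \<circ> inv f) (f x)" for x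
    using bij by (intro orbit_inverse permutation_self_in_orbit) (simp_all add: bij_is_inj)
  have "orbit (f \<circ> \<pi> \<circ> inv f) ` {1..n} = orbit (f \<circ> \<pi> \<circ> inv f) ` f ` {1..n}"
    using permutes_image[OF f] by simp
  also have "\<dots> = (`) f ` orbit \<pi> ` {1..n}"
    unfolding image_image orbit ..
  finally have *: "orbit (f \<circ> \<pi> \<circ> inv f) ` {1..n} = (`) f ` orbit \<pi> ` {1..n}" .
  have inj: "inj ((`) f)" using bij by (auto simp: inj_def inj_image_eq_iff[OF bij_is_inj])
  then have "mset_set ((`) f ` orbit \<pi> ` {1..n}) = image_mset ((`) f) (mset_set (orbit \<pi> ` {1..n}))"
    by (intro image_mset_mset_set[symmetric]) (auto intro: inj_on_subset)
  moreover have "card (f ` A) = card A" for A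
    using bij by (intro card_image) (auto intro: inj_on_subset bij_is_inj)
  ultimately show ?thesis
    unfolding cycle_type_def * by (simp add: image_mset.compositionality comp_def)
qed

text \<open>Three transpositions place the points one at a time. Each later one swaps two values
  different from those already placed, so it leaves these alone. The result serves as a
  conjugator.\<close>

lemma exists_permutes_to_123:
  assumes "{x, y, z} \<subseteq> {1..n}" "x \<noteq> y" "x \<noteq> z" "y \<noteq> z"
  shows "\<exists>f. f permutes {1..n} \<and> f x = 1 \<and> f y = 2 \<and> f z = (3::nat)"
proof -
  have "card {x, y, z} \<le> card {1..n}" using assms(1) by (intro card_mono) auto
  then have n: "3 \<le> n" using assms by (simp add: card_insert_if)
  define f where "f = transpose 1 x"
  have f: "f permutes {1..n}" "f x = 1"
    using n assms unfolding f_def by (auto intro!: permutes_swap_id)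
  have f_inj: "f a = f b \<longleftrightarrow> a = b" for a b using permutes_inj[OF f(1)] by (auto dest: injD)
  have fy: "f y \<noteq> 1" "f z \<noteq> 1" using assms f_inj f(2) by metis+
  have fS: "f a \<in> {1..n}" if "a \<in> {1..n}" for a using that f(1) by (simp only: permutes_in_image)
  define g where "g = transpose 2 (f y)"
  have g: "g permutes {1..n}"
    unfolding g_def using n assms fS by (intro permutes_swap_id) auto
  have g1: "g 1 = 1" "g (f y) = 2"
    using fy by (simp_all add: g_def transpose_def)
  have g_inj: "g a = g b \<longleftrightarrow> a = b" for a b using permutes_inj[OF g] by (auto dest: injD)
  have gz: "g (f z) \<noteq> 1" "g (f z) \<noteq> 2" using assms f_inj g_inj g1 fy by metis+
  have gS: "g a \<in> {1..n}" if "a \<in> {1..n}" for a using that g by (simp only: permutes_in_image)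
  define h where "h = transpose 3 (g (f z))"
  have "h permutes {1..n}"
    unfolding h_def using n assms fS gS by (intro permutes_swap_id) auto
  then have "(h \<circ> g \<circ> f) permutes {1..n}" using f g by (intro permutes_compose)
  moreover have "h 1 = 1" "h 2 = 2" "h (g (f z)) = 3"
    using gz by (auto simp: h_def transpose_def)
  ultimately show ?thesis using f g1 by (intro exI[of _ "h \<circ> g \<circ> f"]) auto
qed

lemma cycle_type_avoiders_eq: "cycle_type_avoiders n = {\<pi> \<in> sym_perms n. \<pi> \<circ> \<pi> = id}"
proof (intro set_eqI iffI)
  fix \<pi> assume "\<pi> \<in> {\<pi> \<in> sym_perms n. \<pi> \<circ> \<pi> = id}"
  then have \<pi>: "\<pi> \<in> sym_perms n" "\<pi> \<circ> \<pi> = id" by auto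
  have "avoids n \<sigma> pat231" if \<sigma>: "\<sigma> \<in> sym_perms n" "same_cycle_type n \<pi> \<sigma>" for \<sigma>
  proof -
    have "\<sigma> \<circ> \<sigma> = id"
      using \<pi> \<sigma> by (simp add: sym_perms_def same_cycle_type_def involution_iff_cycle_type)
    \<comment> \<open>An occurrence would give \<open>\<sigma> (\<sigma> 1) = 3\<close>
      instead.\<close>
    then have "\<sigma> (\<sigma> 1) = 1" by (simp add: fun_eq_iff)
    then show ?thesis using \<sigma> by (auto simp: avoids_pat231_iff)
  qed
  then show "\<pi> \<in> cycle_type_avoiders n"
    using \<pi> by (auto simp: cycle_type_avoiders_def class_avoiders_def same_cycle_type_def)
next
  fix \<pi> assume "\<pi> \<in> cycle_type_avoiders n"
  then have \<pi>: "\<pi> permutes {1..n}" and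
    av: "\<And>\<sigma>. \<sigma> \<in> sym_perms n \<Longrightarrow> same_cycle_type n \<pi> \<sigma> \<Longrightarrow> avoids n \<sigma> pat231"
    by (auto simp: cycle_type_avoiders_def class_avoiders_def sym_perms_def)
  have "\<pi> (\<pi> x) = x" for x
  proof (rule ccontr)
    assume ne: "\<pi> (\<pi> x) \<noteq> x"
    then have x: "x \<in> {1..n}" using permutes_not_in[OF \<pi>] by metis
    have inj: "\<pi> a = \<pi> b \<longleftrightarrow> a = b" for a b using permutes_inj[OF \<pi>] by (auto dest: injD)
    have "{x, \<pi> x, \<pi> (\<pi> x)} \<subseteq> {1..n}"
      using x permutes_in_image[OF \<pi>] by (metis empty_subsetI insert_subset)
    moreover have "x \<noteq> \<pi> x" "x \<noteq> \<pi> (\<pi> x)" "\<pi> x \<noteq> \<pi> (\<pi> x)"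
      using ne by (metis inj)+
    ultimately obtain f where f: "f permutes {1..n}" "f x = 1" "f (\<pi> x) = 2" "f (\<pi> (\<pi> x)) = 3"
      using exists_permutes_to_123 by meson
    \<comment> \<open>Conjugation relabels the path from \<open>x\<close> through
      \<open>\<pi> x\<close> to \<open>\<pi> (\<pi> x)\<close> as 1, 2, 3.\<close>
    define \<sigma> where "\<sigma> = f \<circ> \<pi> \<circ> inv f"
    have "inv f 1 = x" "inv f 2 = \<pi> x"
      using f permutes_inverses(2)[OF f(1)] by metis+
    then have "\<sigma> 1 = 2" "\<sigma> 2 = 3" using f by (simp_all add: \<sigma>_def)
    moreover have "\<sigma> \<in> sym_perms n"
      using f \<pi> by (auto simp: \<sigma>_def sym_perms_def intro!: permutes_compose permutes_inv)
    moreover have "same_cycle_type n \<pi> \<sigma>"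
      by (simp only: \<sigma>_def same_cycle_type_def cycle_type_conjugate[OF f(1) \<pi>])
    ultimately show False using av avoids_pat231_iff by blast
  qed
  then show "\<pi> \<in> {\<pi> \<in> sym_perms n. \<pi> \<circ> \<pi> = id}" using \<pi> by (auto simp: sym_perms_def)
qed

section \<open>Counting involutions\<close>

text \<open>An arbitrary ground set lets the recursion delete any point without renumbering.\<close>

definition involutions :: "'a set \<Rightarrow> ('a \<Rightarrow> 'a) set" where
  "involutions S = {p. p permutes S \<and> p \<circ> p = id}"

fun involution_number :: "nat \<Rightarrow> nat" where
  "involution_number 0 = 1"
| "involution_number (Suc 0) = 1"
| "involution_number (Suc (Suc n)) = involution_number (Suc n) + Suc n * involution_number n"

lemma finite_involutions: "finite S \<Longrightarrow> finite (involutions S)"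
  unfolding involutions_def by (rule finite_subset[OF _ finite_permutations]) auto

lemma involutions_fix:
  assumes "x \<notin> S"
  shows "{p \<in> involutions (insert x S). p x = x} = involutions S"
proof -
  have "p permutes S" if "p permutes (insert x S)" "p x = x" for p
    using that by (auto simp: permutes_def)
  moreover have "p permutes (insert x S) \<and> p x = x" if "p permutes S" for p
    using that assms permutes_subset[OF that] permutes_not_in[OF that] by blast
  ultimately show ?thesis unfolding involutions_def by blast
qed

text \<open>Composing with the transposition adds or removes the 2-cycle on \<open>x\<close> and
  \<open>y\<close> and changes nothing else; the same map is therefore its own inverse.\<close>

lemma involutions_swap:
  assumes "x \<notin> S" "y \<in> S"
  shows "bij_betw (\<lambda>p. transpose x y \<circ> p) (involutions (S - {y}))
           {p \<in> involutions (insert x S). p x = y}"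
proof (rule bij_betwI[where g = "\<lambda>p. transpose x y \<circ> p"])
  show "(\<lambda>p. transpose x y \<circ> p) \<in> involutions (S - {y}) \<rightarrow> {p \<in> involutions (insert x S). p x = y}"
  proof
    fix p assume "p \<in> involutions (S - {y})"
    then have p: "p permutes (S - {y})" "\<And>a. p (p a) = a"
      by (auto simp: involutions_def fun_eq_iff)
    have pxy: "p x = x" "p y = y" using permutes_not_in[OF p(1)] assms by auto
    have "p permutes (insert x S)" using permutes_subset[OF p(1)] by blast
    then have "(transpose x y \<circ> p) permutes (insert x S)"
      using assms by (intro permutes_compose permutes_swap_id) auto
    moreover have "transpose x y (p (transpose x y (p a))) = a" for a
      using p(2) pxy by (metis transpose_apply_first transpose_apply_other transpose_apply_second)
    ultimately show "transpose x y \<circ> p \<in> {p \<in> involutions (insert x S). p x = y}"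
      using pxy by (auto simp: involutions_def)
  qed
  show "(\<lambda>p. transpose x y \<circ> p) \<in> {p \<in> involutions (insert x S). p x = y} \<rightarrow> involutions (S - {y})"
  proof
    fix p assume "p \<in> {p \<in> involutions (insert x S). p x = y}"
    then have p: "p permutes (insert x S)" "\<And>a. p (p a) = a" and pxy: "p x = y" "p y = x"
      by (auto simp: involutions_def fun_eq_iff)
    let ?q = "transpose x y \<circ> p"
    have "?q permutes (insert x S)"
      using assms p by (intro permutes_compose permutes_swap_id) auto
    \<comment> \<open>\<open>?q\<close> fixes both \<open>x\<close> and \<open>y\<close>, so its
      support shrinks to the remaining points.\<close>
    then have "?q permutes (S - {y})"
      by (rule permutes_superset) (auto simp: pxy)
    moreover have "transpose x y (p (transpose x y (p a))) = a" for a
      using p(2) pxy by (metis transpose_apply_first transpose_apply_other transpose_apply_second)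
    ultimately show "?q \<in> involutions (S - {y})"
      by (auto simp: involutions_def)
  qed
qed (auto simp: fun_eq_iff)

text \<open>The involutions are sorted by the image of \<open>x\<close>: either \<open>x\<close> is
  fixed, or it is swapped with some \<open>y\<close> in \<open>S\<close>.\<close>

lemma card_involutions_insert:
  assumes "finite S" "x \<notin> S"
  shows "card (involutions (insert x S)) =
           card (involutions S) + (\<Sum>y\<in>S. card (involutions (S - {y})))"
proof -
  let ?A = "\<lambda>y. {p \<in> involutions (insert x S). p x = y}"
  have fin: "finite (?A y)" for y using assms by (simp add: finite_involutions)
  have "p x \<in> insert x S" if "p \<in> involutions (insert x S)" for p
    using that by (auto simp: involutions_def permutes_in_image simp flip: insert_iff)
  then have "involutions (insert x S) = (\<Union>y\<in>insert x S. ?A y)" by blast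
  also have "card \<dots> = (\<Sum>y\<in>insert x S. card (?A y))"
    using assms fin by (intro card_UN_disjoint) auto
  also have "\<dots> = card (?A x) + (\<Sum>y\<in>S. card (?A y))" using assms by simp
  also have "(\<Sum>y\<in>S. card (?A y)) = (\<Sum>y\<in>S. card (involutions (S - {y})))"
    using bij_betw_same_card[OF involutions_swap[OF assms(2)]] by (intro sum.cong) auto
  finally show ?thesis by (simp only: involutions_fix[OF assms(2)])
qed

lemma card_involutions:
  assumes "finite S"
  shows "card (involutions S) = involution_number (card S)"
  using assms
proof (induction "card S" arbitrary: S rule: involution_number.induct)
  case 1
  then have "involutions S = {id}" by (auto simp: involutions_def)
  then show ?case using 1 by simp
next
  case 2
  then obtain x where "S = {x}" by (metis One_nat_def card_1_singletonE)
  then have "involutions S = {id}" by (auto simp: involutions_def)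
  then show ?case using 2(1)[symmetric] by simp
next
  case (3 n)
  then obtain x T where S: "S = insert x T" "x \<notin> T" "card T = Suc n"
    by (metis card_Suc_eq)
  have fT: "finite T" using 3 S by simp
  \<comment> \<open>All \<open>Suc n\<close> summands are equal, which yields the factor
    \<open>Suc n\<close> of the recurrence.\<close>
  have "card (involutions (T - {y})) = involution_number n" if "y \<in> T" for y
    using 3(2)[of "T - {y}"] that S fT by simp
  moreover have "card (involutions T) = involution_number (Suc n)"
    using 3(1)[of T] S fT by simp
  ultimately have "card (involutions S) = involution_number (Suc (Suc n))"
    using card_involutions_insert[OF fT S(2)] S by simp
  then show ?case using 3(3) by simp
qed

lemma card_cycle_type_avoiders: "card (cycle_type_avoiders n) = involution_number n"
  using card_involutions[of "{1..n}"]
  by (simp add: cycle_type_avoiders_eq sym_perms_def involutions_def)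

section \<open>The exponential generating function\<close>

lemma fps_exp_involutions_nth:
  fixes F :: "rat fps"
  defines "F \<equiv> fps_compose (fps_exp 1) (fps_X + fps_const (1 / 2) * fps_X ^ 2)"
  shows "fps_nth F n = of_nat (involution_number n) / fact n"
proof -
  let ?g = "fps_X + fps_const (1 / 2) * fps_X ^ 2 :: rat fps"
  have "fps_deriv F = fps_compose (fps_deriv (fps_exp 1)) ?g * fps_deriv ?g"
    \<comment> \<open>The chain rule asks for an inner series with zero constant term.\<close>
    unfolding F_def by (rule fps_compose_deriv) (simp add: power2_eq_square)
  also have "fps_deriv ?g = 1 + fps_X"
    by (simp add: power2_eq_square) (simp add: fps_eq_iff fps_numeral_nth)
  finally have ode: "fps_deriv F = F + fps_X * F"
    by (simp add: F_def algebra_simps)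
  have F0: "fps_nth F 0 = 1" by (simp add: F_def fps_compose_nth)
  \<comment> \<open>The constant coefficient of the differential equation supplies the second
    initial value; its higher coefficients give the recurrence.\<close>
  have F1: "fps_nth F (Suc 0) = 1" using arg_cong[OF ode, of "\<lambda>f. fps_nth f 0"] F0 by simp
  have rec: "of_nat (Suc (Suc n)) * fps_nth F (Suc (Suc n)) = fps_nth F (Suc n) + fps_nth F n" for n
    using arg_cong[OF ode, of "\<lambda>f. fps_nth f (Suc n)"] by (simp add: fps_deriv_nth)
  show ?thesis
  proof (induction n rule: involution_number.induct)
    case (3 n)
    have "fps_nth F (Suc (Suc n)) = (fps_nth F (Suc n) + fps_nth F n) / of_nat (Suc (Suc n))"
      using rec[of n] by (simp add: field_simps del: of_nat_Suc)
    \<comment> \<open>Expanding the fraction by \<open>Suc n\<close> brings both terms over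
      \<open>fact (Suc n)\<close> and exposes the second summand of the recurrence.\<close>
    also have "fps_nth F n = of_nat (Suc n) * of_nat (involution_number n) / fact (Suc n)"
      unfolding 3 by (simp add: divide_simps del: of_nat_Suc)
    also have "(fps_nth F (Suc n) + \<dots>) / of_nat (Suc (Suc n)) =
        of_nat (involution_number (Suc (Suc n))) / fact (Suc (Suc n))"
      unfolding 3 fact_Suc[of "Suc n"]
      by (simp add: add_divide_distrib mult.commute del: of_nat_Suc fact_Suc mult_Suc)
    finally show ?case .
  qed (simp_all add: F0 F1)
qed

theorem proposition3p6:
  shows "(\<forall>n\<ge>1. cycle_type_avoiders n = {\<pi> \<in> sym_perms n. \<pi> \<circ> \<pi> = id}) \<and>
         map (\<lambda>n. card (cycle_type_avoiders n)) [1..<10] = [1, 2, 4, 10, 26, 76, 232, 764, 2620] \<and>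
         egf (\<lambda>n. card (cycle_type_avoiders n)) =
           fps_compose (fps_exp 1) (fps_X + fps_const (1 / 2) * fps_X ^ 2)"
proof (intro conjI)
  show "\<forall>n\<ge>1. cycle_type_avoiders n = {\<pi> \<in> sym_perms n. \<pi> \<circ> \<pi> = id}"
    by (simp add: cycle_type_avoiders_eq)
  show "map (\<lambda>n. card (cycle_type_avoiders n)) [1..<10] = [1, 2, 4, 10, 26, 76, 232, 764, 2620]"
    by (simp add: card_cycle_type_avoiders upt_rec numeral_eq_Suc)
  show "egf (\<lambda>n. card (cycle_type_avoiders n)) =
      fps_compose (fps_exp 1) (fps_X + fps_const (1 / 2) * fps_X ^ 2)"
    \<comment> \<open>The prescribed constant term agrees with
      \<open>involution_number 0 = 1\<close>.\<close>
    by (auto simp: egf_def card_cycle_type_avoiders fps_exp_involutions_nth intro!: fps_ext)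
qed

end
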